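(* Let $Y$ be a real random variable whose moment generating function $E[e^{tY}]$ exists for $|t|<\rho$ for some $\rho>0$. For all integers $n\ge r\ge 0$, $$D_{n}^{(r,Y)}= n!\sum_{k=r}^{n}\binom{k}{r}(-1)^{n-k}\frac{E[Y^{n-k}]}{(n-k)!}.$$
   Context: For an integer $r\ge 0$, the probabilistic $r$-derangement numbers $D_n^{(r,Y)}$ ($n\ge r$) associated with $Y$ are defined by the generating function (for $t$ near $0$) $$\frac{t^{r}}{(1-t)^{r+1}}E\big[e^{-Yt}\big]=\sum_{n=r}^{\infty}D_{n}^{(r,Y)}\frac{t^{n}}{n!}.$$ *)

theory Defs
  imports "HOL-Probability.Probability"
begin

text \<open>
  The probabilistic \<open>r\<close>-derangement numbers of a real random variable \<open>Y\<close> on \<open>M\<close>: the sequence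
  \<open>D n\<close> (\<open>n \<ge> r\<close>) of coefficients in the exponential generating function below, whose series is
  indexed from \<open>r\<close> and required to converge to the left-hand side for all real \<open>t\<close> near \<open>0\<close>.
  The paper leaves the values for \<open>n < r\<close> unspecified; they are set to \<open>0\<close> only so that the
  sequence is unique. If the moment generating function of \<open>Y\<close> exists near \<open>0\<close>, the
  generating function is analytic at \<open>0\<close> with a zero of order \<open>r\<close>, so such a sequence exists.
\<close>

definition prob_r_derangement :: "'a measure \<Rightarrow> ('a \<Rightarrow> real) \<Rightarrow> nat \<Rightarrow> nat \<Rightarrow> real" where
  "prob_r_derangement M Y r =
     (THE D. (\<forall>n<r. D n = 0) \<and>
        (\<forall>\<^sub>F t in nhds 0.
           (\<lambda>n. D (n + r) * (t ^ (n + r) / fact (n + r))) sums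
             (t ^ r / (1 - t) ^ (r + 1) * prob_space.expectation M (\<lambda>\<omega>. exp (- Y \<omega> * t)))))"

end

theory Submission
  imports Defs
begin

text \<open>
  The generating function is a product of two absolutely convergent power series in \<open>t\<close>. The
  rational factor contributes \<open>t ^ r / (1 - t) ^ (r + 1) = (\<Sum>k\<ge>r. (k choose r) * t ^ k)\<close>
  (\<open>negative_binomial_sums\<close>), and the expectation contributes
  \<open>(\<Sum>m. (-1) ^ m * E[Y ^ m] / m! * t ^ m)\<close>, because a moment generating function that is
  finite on both sides of \<open>0\<close> dominates all partial sums of the exponential series, so that sum
  and expectation may be exchanged (\<open>mgf_sums_moments\<close>). The Cauchy product of the two has the
  claimed convolution as its coefficients.

  As the numbers are defined by a description operator, it remains to see that no other sequence
  has the same generating function: the difference of two candidates gives a power series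
  that vanishes in a punctured neighbourhood of \<open>0\<close>, and hence has zero coefficients
  (\<open>powser_zero_imp_coeffs_zero\<close>).
\<close>

text \<open>
  Once \<open>a 0, \<dots>, a (n - 1)\<close> are known to vanish, dividing the series by \<open>x ^ n\<close> leaves a
  power series that is zero off the origin and whose limit at \<open>0\<close> is \<open>a n\<close>. The
  origin is excluded in the hypothesis so that the lemma applies to a series obtained by dividing
  by a power of \<open>x\<close>.
\<close>

lemma powser_zero_imp_coeffs_zero:
  fixes a :: "nat \<Rightarrow> 'a::{real_normed_field,banach}"
  assumes "s > 0" and zero: "\<And>x. x \<noteq> 0 \<Longrightarrow> norm x < s \<Longrightarrow> (\<lambda>n. a n * x ^ n) sums 0"
  shows "a n = 0"
proof (induction n rule: less_induct)
  case (less n)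
  have "(\<lambda>i. a (i + n) * x ^ i) sums 0" if x: "x \<noteq> 0" "norm x < s" for x
  proof -
    have "(\<Sum>i<n. a i * x ^ i) = 0"
      using less by simp
    then have "(\<lambda>i. a (i + n) * x ^ (i + n)) sums 0"
      using zero[OF x] by (subst sums_iff_shift) simp
    then have "(\<lambda>i. a (i + n) * x ^ (i + n) / x ^ n) sums (0 / x ^ n)"
      by (rule sums_divide)
    then show ?thesis
      using x by (simp add: power_add)
  qed
  then have "((\<lambda>_. 0) \<longlongrightarrow> a (0 + n)) (at (0::'a))"
    by (rule powser_limit_0_strong[OF \<open>s > 0\<close>])
  then show ?case
    by (simp add: tendsto_const_iff)
qed

text \<open>
  Multiplying by one more geometric series replaces the coefficients by their partial sums, and
  these are binomial coefficients again by the hockey-stick identity \<open>choose_rising_sum\<close>.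
  Absolute convergence is carried through the induction because the Cauchy product needs it; it
  comes from the same expansion at \<open>norm t\<close>.
\<close>

lemma negative_binomial_sums:
  fixes t :: real
  assumes "\<bar>t\<bar> < 1"
  shows "(\<lambda>k. real ((r + k) choose r) * t ^ k) sums (1 / (1 - t) ^ (r + 1))"
    and "summable (\<lambda>k. norm (real ((r + k) choose r) * t ^ k))"
proof -
  have "\<bar>t\<bar> < 1 \<longrightarrow> (\<lambda>k. real ((r + k) choose r) * t ^ k) sums (1 / (1 - t) ^ (r + 1))" for t :: real
  proof (induction r arbitrary: t)
    case 0
    then show ?case
      using geometric_sums[of t] by simp
  next
    case (Suc r)
    show ?case
    proof
      assume t: "\<bar>t\<bar> < 1"
      have "summable (\<lambda>k. real ((r + k) choose r) * \<bar>t\<bar> ^ k)"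
        using Suc[of "\<bar>t\<bar>"] t by (auto dest: sums_summable)
      then have "summable (\<lambda>k. norm (real ((r + k) choose r) * t ^ k))"
        by (simp add: abs_mult power_abs)
      moreover have "summable (\<lambda>k. norm (t ^ k))"
        using t by (simp add: power_abs summable_geometric)
      ultimately have "(\<lambda>k. \<Sum>i\<le>k. real ((r + i) choose r) * t ^ i * t ^ (k - i)) sums
          ((\<Sum>k. real ((r + k) choose r) * t ^ k) * (\<Sum>k. t ^ k))"
        by (rule Cauchy_product_sums)
      moreover have "(\<Sum>k. real ((r + k) choose r) * t ^ k) = 1 / (1 - t) ^ (r + 1)"
        using Suc[of t] t sums_unique by metis
      moreover have "(\<Sum>k. t ^ k) = 1 / (1 - t)"
        using t by (simp add: suminf_geometric)
      moreover have "(\<Sum>i\<le>k. real ((r + i) choose r) * t ^ i * t ^ (k - i)) =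
          real ((Suc r + k) choose Suc r) * t ^ k" for k
      proof -
        have "(\<Sum>i\<le>k. real ((r + i) choose r) * t ^ i * t ^ (k - i)) =
            (\<Sum>i\<le>k. real ((r + i) choose r)) * t ^ k"
          unfolding sum_distrib_right by (rule sum.cong) (auto simp flip: power_add)
        also have "(\<Sum>i\<le>k. real ((r + i) choose r)) = real ((Suc r + k) choose Suc r)"
          using choose_rising_sum(1)[of r k] by (simp flip: of_nat_sum)
        finally show ?thesis .
      qed
      ultimately show "(\<lambda>k. real ((Suc r + k) choose Suc r) * t ^ k) sums (1 / (1 - t) ^ (Suc r + 1))"
        by (simp add: mult.commute)
    qed
  qed
  note * = this
  show "(\<lambda>k. real ((r + k) choose r) * t ^ k) sums (1 / (1 - t) ^ (r + 1))"
    using * assms by blast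
  have "summable (\<lambda>k. real ((r + k) choose r) * \<bar>t\<bar> ^ k)"
    using *[of "\<bar>t\<bar>"] assms by (auto dest: sums_summable)
  then show "summable (\<lambda>k. norm (real ((r + k) choose r) * t ^ k))"
    by (simp add: abs_mult power_abs)
qed

text \<open>
  Every partial sum of \<open>\<Sum>k. \<bar>t * Y\<bar> ^ k / k!\<close> is at most
  \<open>exp \<bar>t * Y\<bar> \<le> exp (t * Y) + exp (- t * Y)\<close>. The two-sided integrability hypothesis thus
  gives the moments, the absolute convergence and the exchange of sum and integral.
\<close>

lemma mgf_sums_moments:
  fixes Y :: "'a \<Rightarrow> real" and t :: real
  assumes [measurable]: "Y \<in> borel_measurable M"
    and pos: "integrable M (\<lambda>\<omega>. exp (t * Y \<omega>))"
    and neg: "integrable M (\<lambda>\<omega>. exp (- t * Y \<omega>))"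
  shows "(\<lambda>k. integral\<^sup>L M (\<lambda>\<omega>. Y \<omega> ^ k) / fact k * t ^ k) sums
           integral\<^sup>L M (\<lambda>\<omega>. exp (t * Y \<omega>))"
    and "summable (\<lambda>k. norm (integral\<^sup>L M (\<lambda>\<omega>. Y \<omega> ^ k) / fact k * t ^ k))"
proof -
  define f where "f k \<omega> = (t * Y \<omega>) ^ k / fact k" for k \<omega>
  define g where "g \<omega> = exp (t * Y \<omega>) + exp (- t * Y \<omega>)" for \<omega>
  have [measurable]: "f k \<in> borel_measurable M" for k
    unfolding f_def by measurable
  have g: "integrable M g"
    unfolding g_def using pos neg by (rule Bochner_Integration.integrable_add)
  have norm_f: "(\<lambda>k. norm (f k \<omega>)) sums exp \<bar>t * Y \<omega>\<bar>" for \<omega>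
    using exp_converges[of "\<bar>t * Y \<omega>\<bar>"] by (simp add: f_def abs_mult power_abs power_mult_distrib divide_inverse mult_ac)
  have partial: "(\<Sum>k<n. norm (f k \<omega>)) \<le> g \<omega>" for n \<omega>
  proof -
    have "(\<Sum>k<n. norm (f k \<omega>)) \<le> exp \<bar>t * Y \<omega>\<bar>"
      using sum_le_suminf[OF sums_summable[OF norm_f], of "{..<n}" \<omega>] sums_unique[OF norm_f[of \<omega>]]
      by simp
    also have "\<dots> \<le> g \<omega>"
      by (auto simp: g_def abs_if)
    finally show ?thesis .
  qed
  have f: "integrable M (f k)" for k
  proof (rule Bochner_Integration.integrable_bound[OF g])
    have "norm (f k \<omega>) \<le> norm (g \<omega>)" for \<omega>
    proof -
      have "norm (f k \<omega>) \<le> (\<Sum>k<Suc k. norm (f k \<omega>))"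
        by (simp add: sum_nonneg)
      also note partial
      finally show ?thesis by simp
    qed
    then show "AE \<omega> in M. norm (f k \<omega>) \<le> norm (g \<omega>)" by simp
  qed simp
  have summable: "summable (\<lambda>k. integral\<^sup>L M (\<lambda>\<omega>. norm (f k \<omega>)))"
  proof (rule summableI_nonneg_bounded)
    fix n
    have "(\<Sum>k<n. integral\<^sup>L M (\<lambda>\<omega>. norm (f k \<omega>))) = integral\<^sup>L M (\<lambda>\<omega>. \<Sum>k<n. norm (f k \<omega>))"
      using f by (subst Bochner_Integration.integral_sum) auto
    also have "\<dots> \<le> integral\<^sup>L M g"
      using f g partial by (intro integral_mono Bochner_Integration.integrable_sum) auto
    finally show "(\<Sum>k<n. integral\<^sup>L M (\<lambda>\<omega>. norm (f k \<omega>))) \<le> integral\<^sup>L M g" .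
  qed simp
  have int_f: "integral\<^sup>L M (f k) = integral\<^sup>L M (\<lambda>\<omega>. Y \<omega> ^ k) / fact k * t ^ k" for k
  proof -
    have "f k = (\<lambda>\<omega>. t ^ k / fact k * Y \<omega> ^ k)"
      by (auto simp: f_def power_mult_distrib)
    then show ?thesis by simp
  qed
  have "(\<lambda>k. integral\<^sup>L M (f k)) sums integral\<^sup>L M (\<lambda>\<omega>. \<Sum>k. f k \<omega>)"
    using f norm_f[THEN sums_summable] summable by (intro sums_integral) auto
  moreover have "(\<Sum>k. f k \<omega>) = exp (t * Y \<omega>)" for \<omega>
    using exp_converges[of "t * Y \<omega>", THEN sums_unique]
    by (simp add: f_def divide_inverse mult.commute)
  ultimately show "(\<lambda>k. integral\<^sup>L M (\<lambda>\<omega>. Y \<omega> ^ k) / fact k * t ^ k) sums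
           integral\<^sup>L M (\<lambda>\<omega>. exp (t * Y \<omega>))"
    by (simp add: int_f)
  show "summable (\<lambda>k. norm (integral\<^sup>L M (\<lambda>\<omega>. Y \<omega> ^ k) / fact k * t ^ k))"
  proof (rule summable_comparison_test[OF _ summable], intro exI allI impI)
    fix k
    show "norm (norm (integral\<^sup>L M (\<lambda>\<omega>. Y \<omega> ^ k) / fact k * t ^ k)) \<le>
        integral\<^sup>L M (\<lambda>\<omega>. norm (f k \<omega>))"
      using integral_norm_bound[of M "f k"] unfolding int_f by simp
  qed
qed

text \<open>
  This isolates the uniqueness half of the description: a sequence that starts with \<open>r\<close>
  zeros is determined by any function that its exponential series represents near \<open>0\<close>.
\<close>

lemma shifted_egf_unique:
  fixes D D' :: "nat \<Rightarrow> real" and F :: "real \<Rightarrow> real"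
  assumes "\<forall>n<r. D n = 0" and "\<forall>n<r. D' n = 0"
    and "\<forall>\<^sub>F t in nhds 0. (\<lambda>n. D (n + r) * (t ^ (n + r) / fact (n + r))) sums F t"
    and "\<forall>\<^sub>F t in nhds 0. (\<lambda>n. D' (n + r) * (t ^ (n + r) / fact (n + r))) sums F t"
  shows "D = D'"
proof
  define a where "a n = (D (n + r) - D' (n + r)) / fact (n + r)" for n
  have "\<forall>\<^sub>F t in nhds 0. (\<lambda>n. a n * t ^ n * t ^ r) sums 0"
    using assms(3,4)
  proof eventually_elim
    case (elim t)
    from sums_diff[OF this] show ?case
      by (simp add: a_def power_add diff_divide_distrib algebra_simps)
  qed
  then obtain s where s: "s > 0" "\<And>t. \<bar>t\<bar> < s \<Longrightarrow> (\<lambda>n. a n * t ^ n * t ^ r) sums 0"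
    by (auto simp: eventually_nhds_metric dist_real_def)
  have "(\<lambda>n. a n * t ^ n) sums 0" if "t \<noteq> 0" "\<bar>t\<bar> < s" for t
    using sums_divide[OF s(2)[OF that(2)], of "t ^ r"] that(1) by simp
  then have a: "a n = 0" for n
    using powser_zero_imp_coeffs_zero[OF s(1), of a] by simp
  fix n
  show "D n = D' n"
  proof (cases "n < r")
    case False
    then show ?thesis using a[of "n - r"] by (simp add: a_def)
  qed (use assms in simp)
qed

theorem theorem2p5:
  fixes M :: "'a measure" and Y :: "'a \<Rightarrow> real" and \<rho> :: real and n r :: nat
  assumes "prob_space M"
    and "Y \<in> borel_measurable M"
    and "\<rho> > 0"
    and "\<And>t :: real. \<bar>t\<bar> < \<rho> \<Longrightarrow> integrable M (\<lambda>\<omega>. exp (t * Y \<omega>))"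
    and "r \<le> n"
  shows "prob_r_derangement M Y r n =
    fact n * (\<Sum>k = r..n. real (k choose r) * (- 1) ^ (n - k) *
                (prob_space.expectation M (\<lambda>\<omega>. Y \<omega> ^ (n - k)) / fact (n - k)))"
proof -
  define m where "m k = integral\<^sup>L M (\<lambda>\<omega>. Y \<omega> ^ k)" for k
  (* For n < r the interval is empty, so D n = 0 there, as the definition asks. *)
  define D where
    "D n = fact n * (\<Sum>k = r..n. real (k choose r) * (- 1) ^ (n - k) * (m (n - k) / fact (n - k)))"
    for n
  define F where "F t = t ^ r / (1 - t) ^ (r + 1) * integral\<^sup>L M (\<lambda>\<omega>. exp (- Y \<omega> * t))" for t
  have D_sums: "(\<lambda>n. D (n + r) * (t ^ (n + r) / fact (n + r))) sums F t"
    if t: "\<bar>t\<bar> < min 1 \<rho>" for t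
  proof -
    define b where "b k = real ((r + k) choose r) * t ^ k" for k
    define c where "c k = m k / fact k * (- t) ^ k" for k
    have c: "c sums integral\<^sup>L M (\<lambda>\<omega>. exp (- Y \<omega> * t))" "summable (\<lambda>k. norm (c k))"
      using mgf_sums_moments[of Y M "- t"] assms(2) assms(4)[of t] assms(4)[of "- t"] t
      by (simp_all add: c_def[abs_def] m_def mult.commute)
    have b: "b sums (1 / (1 - t) ^ (r + 1))" "summable (\<lambda>k. norm (b k))"
      using negative_binomial_sums[of t r] t by (simp_all add: b_def[abs_def])
    have "(\<lambda>k. \<Sum>i\<le>k. b i * c (k - i)) sums
        (1 / (1 - t) ^ (r + 1) * integral\<^sup>L M (\<lambda>\<omega>. exp (- Y \<omega> * t)))"
      using Cauchy_product_sums[OF b(2) c(2)] sums_unique[OF b(1)] sums_unique[OF c(1)] by simp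
    then have "(\<lambda>k. t ^ r * (\<Sum>i\<le>k. b i * c (k - i))) sums F t"
      unfolding F_def by (auto dest: sums_mult[of _ _ "t ^ r"])
    moreover have "t ^ r * (\<Sum>i\<le>k. b i * c (k - i)) = D (k + r) * (t ^ (k + r) / fact (k + r))"
      for k
    proof -
      have "D (k + r) * (t ^ (k + r) / fact (k + r)) =
          (\<Sum>j = 0 + r..k + r. real (j choose r) * (- 1) ^ (k + r - j) *
            (m (k + r - j) / fact (k + r - j))) * t ^ (k + r)"
        by (simp add: D_def)
      also have "\<dots> = (\<Sum>i\<le>k. real ((r + i) choose r) * (- 1) ^ (k - i) *
            (m (k - i) / fact (k - i))) * t ^ (k + r)"
        by (subst sum.shift_bounds_cl_nat_ivl) (simp add: atLeast0AtMost add.commute)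
      also have "\<dots> = t ^ r * (\<Sum>i\<le>k. b i * c (k - i))"
        unfolding sum_distrib_left sum_distrib_right
      proof (rule sum.cong)
        fix i assume "i \<in> {..k}"
        then have "t ^ (k + r) = t ^ r * (t ^ i * t ^ (k - i))"
          by (simp add: add.commute flip: power_add)
        then show "real ((r + i) choose r) * (- 1) ^ (k - i) * (m (k - i) / fact (k - i)) * t ^ (k + r)
            = t ^ r * (b i * c (k - i))"
          by (simp add: b_def c_def power_minus[of t])
      qed simp
      finally show ?thesis by simp
    qed
    ultimately show ?thesis by simp
  qed
  have D_ev: "\<forall>\<^sub>F t in nhds 0. (\<lambda>n. D (n + r) * (t ^ (n + r) / fact (n + r))) sums F t"
    unfolding eventually_nhds_metric
    using D_sums assms(3) by (intro exI[of _ "min 1 \<rho>"]) (auto simp: dist_real_def)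
  have "prob_r_derangement M Y r = D"
    unfolding prob_r_derangement_def F_def[symmetric]
  proof (rule the_equality)
    show D: "(\<forall>n<r. D n = 0) \<and>
        (\<forall>\<^sub>F t in nhds 0. (\<lambda>n. D (n + r) * (t ^ (n + r) / fact (n + r))) sums F t)"
      using D_ev by (simp add: D_def)
    show "D' = D" if "(\<forall>n<r. D' n = 0) \<and>
        (\<forall>\<^sub>F t in nhds 0. (\<lambda>n. D' (n + r) * (t ^ (n + r) / fact (n + r))) sums F t)" for D'
      using shifted_egf_unique[of r D' D F] that D by blast
  qed
  then show ?thesis
    by (simp add: D_def m_def)
qed

end
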